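(* Let $f:\mathcal{X}\to\mathbb{R}$ be a convex differentiable function on the open domain $\mathcal{X}$ that is closed (all sublevel sets $\{\mathbf{x}\in\mathcal{X}: f(\mathbf{x})\le a\}$, $a\in\mathbb{R}$, are closed), and suppose $f\in\mathcal{F}_{\ell}(\|\cdot\|)$ with $\ell$ sub-quadratic, i.e. $\lim_{\alpha\to\infty}\alpha^2/\ell(\alpha)=\infty$. Let $\mathbf{x}_0=\operatorname{argmin}_{\mathbf{x}\in\mathcal{X}}\psi(\mathbf{x})$ and $$G:=\sup\{\alpha\in\mathbb{R}_+ : \alpha^2\le 2\ell(2\alpha)(f(\mathbf{x}_0)-f^* )\},\qquad L:=\ell(2G).$$ Let $0<\eta\le 1/L$ and let $(\mathbf{x}_t)_{t\in\mathbb{N}}$ be generated by mirror descent, $\mathbf{x}_{t+1}=\mathcal{P}_{\mathbf{x}_t}(\eta\nabla f(\mathbf{x}_t))$. Then $\|\nabla f(\mathbf{x}_t)\|_*\le G$ for all $t\in\mathbb{N}$, and for every $T\in\mathbb{N}_+$, with $\overline{\mathbf{x}}_T=\frac1T\sum_{t=1}^T\mathbf{x}_t$, $$\max\{f(\overline{\mathbf{x}}_T)-f^*,\ f(\mathbf{x}_T)-f^*\}\le\frac{B(\mathbf{x}_*,\mathbf{x}_0)}{\eta T}.$$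
   Context: $\mathcal{E}$ is a finite-dimensional real Banach space with norm $\|\cdot\|$, dual space $\mathcal{E}^*$ and dual norm $\|\mathbf{u}\|_*:=\sup\{\langle\mathbf{u},\mathbf{y}\rangle:\|\mathbf{y}\|\le1\}$. $\mathcal{X}\subseteq\mathcal{E}$ is convex. $\mathbb{R}_+$ (resp. $\mathbb{R}_{++}$) is the set of nonnegative (resp. positive) reals; $\mathbb{N}$ includes $0$ and $\mathbb{N}_+$ is the set of positive integers. $\mathbf{x}_*\in\operatorname{argmin}_{\mathbf{x}\in\mathcal{X}}f(\mathbf{x})$ is a minimizer (assumed to exist) and $f^*=f(\mathbf{x}_* )$. $\ell*$-smoothness: for a non-decreasing continuous $\ell:\mathbb{R}_+\to\mathbb{R}_{++}$, a differentiable $f:\mathcal{X}\to\mathbb{R}$ belongs to $\mathcal{F}_\ell(\|\cdot\|)$ if for almost every $\mathbf{x}\in\mathcal{X}$: $\|\nabla^2f(\mathbf{x})\mathbf{h}\|_*\le\ell(\|\nabla f(\mathbf{x})\|_* )\|\mathbf{h}\|$ for all $\mathbf{h}\in\mathcal{X}$. Mirror map: $\psi:\mathcal{X}\to\mathbb{R}_+$ is a continuous distance-generating function: $\mathcal{X}^o=\{\mathbf{x}\in\mathcal{X}:\partial\psi(\mathbf{x})\ne\emptyset\}$ is convex, $\psi$ is continuously differentiable and $1$-strongly convex w.r.t. $\|\cdot\|$, i.e. $\langle\nabla\psi(\mathbf{x}_1)-\nabla\psi(\mathbf{x}_2),\mathbf{x}_1-\mathbf{x}_2\rangle\ge\|\mathbf{x}_1-\mathbf{x}_2\|^2$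 for $\mathbf{x}_1,\mathbf{x}_2\in\mathcal{X}^o$. Bregman function: $B(\mathbf{x},\mathbf{x}^o)=\psi(\mathbf{x})-\psi(\mathbf{x}^o)-\langle\nabla\psi(\mathbf{x}^o),\mathbf{x}-\mathbf{x}^o\rangle$ for $\mathbf{x}\in\mathcal{X},\mathbf{x}^o\in\mathcal{X}^o$. Prox-mapping: $\mathcal{P}_{\mathbf{y}}(\mathbf{g}):=\operatorname{argmin}_{\mathbf{x}\in\mathcal{X}}\{\langle\mathbf{g},\mathbf{x}\rangle+B(\mathbf{x},\mathbf{y})\}$; the argmins defining $\mathbf{x}_0$ and the iterates are assumed to be attained.
   Formalization: Membership of f in F_ℓ is taken to include that ∇f is locally Lipschitz (with only a pointwise a.e. Hessian the claim fails, e.g. f' = Cantor function − 1/2), and the Hessian bound is required for all directions h in the whole space E rather than only h in X. *)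

theory Defs
  imports "HOL-Analysis.Analysis"
begin

text \<open>
  The space is a type of class \<open>banach\<close>, assumed finite-dimensional where needed; its dual is
  \<open>'a \<Rightarrow>\<^sub>L real\<close>, whose library norm is the dual norm, as the following fact records.
\<close>

lemma dual_norm_eq_Sup:
  fixes u :: "'a::real_normed_vector \<Rightarrow>\<^sub>L real"
  shows "norm u = Sup {blinfun_apply u y | y. norm y \<le> 1}"
proof -
  let ?S = "{blinfun_apply u y | y. norm y \<le> 1}"
  have le: "s \<le> norm u" if "s \<in> ?S" for s
  proof -
    from that obtain y where y: "s = blinfun_apply u y" "norm y \<le> 1" by blast
    have "\<bar>blinfun_apply u y\<bar> \<le> norm u * norm y"
      using norm_blinfun[of u y] by simp
    also have "\<dots> \<le> norm u"
      using mult_left_mono[OF y(2), of "norm u"] by simp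
    finally show ?thesis using y(1) by linarith
  qed
  have bdd: "bdd_above ?S" using le by (rule bdd_aboveI)
  have ne: "?S \<noteq> {}" by (auto intro!: exI[of _ 0])
  have S0: "0 \<le> Sup ?S"
    using bdd by (intro cSup_upper) (auto intro!: exI[of _ 0] simp: blinfun.zero_right)
  have "norm (blinfun_apply u z) \<le> Sup ?S * norm z" for z
  proof (cases "z = 0")
    case False
    let ?w = "(sgn (blinfun_apply u z) / norm z) *\<^sub>R z"
    have "norm ?w \<le> 1" using False by (simp add: sgn_if)
    then have "blinfun_apply u ?w \<le> Sup ?S" using bdd by (intro cSup_upper) blast+
    moreover have "blinfun_apply u ?w = \<bar>blinfun_apply u z\<bar> / norm z"
      by (simp add: blinfun.scaleR_right sgn_if)
    ultimately show ?thesis using False by (simp add: field_simps)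
  qed (simp add: blinfun.zero_right)
  then have "norm u \<le> Sup ?S" using S0 by (intro norm_blinfun_bound)
  moreover have "Sup ?S \<le> norm u" using le ne by (intro cSup_least)
  ultimately show ?thesis by simp
qed

definition dgrad :: "('a::real_normed_vector \<Rightarrow> real) \<Rightarrow> 'a \<Rightarrow> 'a \<Rightarrow>\<^sub>L real" where
  "dgrad f x = Blinfun (frechet_derivative f (at x))"

lemma dgrad_eqI: "(f has_derivative blinfun_apply u) (at x) \<Longrightarrow> dgrad f x = u"
  by (metis blinfun_apply_inverse dgrad_def frechet_derivative_at)

text \<open>
  Almost everywhere on a subset of a finite-dimensional normed space: Lebesgue measure is
  transported from the coordinate space by a linear basis \<open>B\<close>. Changing the basis multiplies it by
  a positive constant, so the null sets do not depend on \<open>B\<close>.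
\<close>

definition almost_everywhere_on :: "'a::real_normed_vector set \<Rightarrow> ('a \<Rightarrow> bool) \<Rightarrow> bool" where
  "almost_everywhere_on X P \<longleftrightarrow>
     (\<exists>B. finite B \<and> independent B \<and> span B = UNIV \<and>
       (AE c in (\<Pi>\<^sub>M b\<in>B. lborel).
          (\<Sum>b\<in>B. c b *\<^sub>R b) \<in> X \<longrightarrow> P (\<Sum>b\<in>B. c b *\<^sub>R b)))"

text \<open>
  The class \<open>\<F>\<^sub>\<ell>\<close> of \<open>\<ell>*\<close>-smooth functions. The pointwise Hessian determines the gradient only if
  the gradient is regular enough: if \<open>f'\<close> is the Cantor function, then \<open>f''\<close> is zero almost
  everywhere but \<open>f'\<close> is not constant. Hence the Hessian defined almost everywhere is taken to be
  that of a function with locally Lipschitz gradient (Rademacher). For continuous gradients and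
  locally bounded right-hand sides, this is the same as taking it as the weak derivative of the
  gradient. The Hessian bound is an operator-norm bound: the direction \<open>h\<close> ranges over the whole
  space, not only over \<open>X\<close>.
\<close>

definition ell_smooth_class ::
    "(real \<Rightarrow> real) \<Rightarrow> 'a::real_normed_vector set \<Rightarrow> ('a \<Rightarrow> real) set" where
  "ell_smooth_class ell X = {f.
     (\<forall>x\<in>X. f differentiable (at x)) \<and>
     (\<forall>x\<in>X. \<exists>r>0. \<exists>K. K-lipschitz_on (ball x r \<inter> X) (dgrad f)) \<and>
     almost_everywhere_on X (\<lambda>x. \<exists>H. (dgrad f has_derivative H) (at x) \<and>
        (\<forall>h. norm (H h) \<le> ell (norm (dgrad f x)) * norm h))}"

definition subdiff ::
    "'a::real_normed_vector set \<Rightarrow> ('a \<Rightarrow> real) \<Rightarrow> 'a \<Rightarrow> ('a \<Rightarrow>\<^sub>L real) set" where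
  "subdiff X \<psi> x = {u. \<forall>y\<in>X. \<psi> y \<ge> \<psi> x + blinfun_apply u (y - x)}"

definition subdiff_dom :: "'a::real_normed_vector set \<Rightarrow> ('a \<Rightarrow> real) \<Rightarrow> 'a set" where
  "subdiff_dom X \<psi> = {x \<in> X. subdiff X \<psi> x \<noteq> {}}"

definition mirror_map :: "'a::real_normed_vector set \<Rightarrow> ('a \<Rightarrow> real) \<Rightarrow> bool" where
  "mirror_map X \<psi> \<longleftrightarrow>
     (\<forall>x\<in>X. 0 \<le> \<psi> x) \<and> continuous_on X \<psi> \<and>
     convex (subdiff_dom X \<psi>) \<and>
     (\<forall>x\<in>subdiff_dom X \<psi>. \<psi> differentiable (at x)) \<and>
     continuous_on (subdiff_dom X \<psi>) (dgrad \<psi>) \<and>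
     (\<forall>x\<in>subdiff_dom X \<psi>. \<forall>y\<in>subdiff_dom X \<psi>.
        blinfun_apply (dgrad \<psi> x - dgrad \<psi> y) (x - y) \<ge> (norm (x - y))\<^sup>2)"

definition bregman :: "('a::real_normed_vector \<Rightarrow> real) \<Rightarrow> 'a \<Rightarrow> 'a \<Rightarrow> real" where
  "bregman \<psi> x y = \<psi> x - \<psi> y - blinfun_apply (dgrad \<psi> y) (x - y)"

text \<open>The prox-mapping is the set of minimizers.\<close>

definition prox ::
    "'a::real_normed_vector set \<Rightarrow> ('a \<Rightarrow> real) \<Rightarrow> 'a \<Rightarrow> ('a \<Rightarrow>\<^sub>L real) \<Rightarrow> 'a set" where
  "prox X \<psi> y g =
     {z. is_arg_min (\<lambda>z. blinfun_apply g z + bregman \<psi> z y) (\<lambda>z. z \<in> X) z}"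

end

theory Submission
  imports Defs "HOL-Probability.Probability_Measure"
begin

text \<open>
  Averaging the gradient over a small box and differentiating under the integral turns the almost
  everywhere Hessian bound into a local Lipschitz bound: \<open>\<nabla>f\<close> is locally \<open>\<ell>(C)\<close>-Lipschitz where
  \<open>\<parallel>\<nabla>f\<parallel> < C\<close>. Within distance \<open>G / \<ell>(2G)\<close> of a point with gradient norm at most \<open>G\<close> the gradient
  norm stays below \<open>2G\<close>, so there \<open>f\<close> satisfies the descent inequality with constant
  \<open>\<ell>(2G)\<close>. A step of that length in a steepest descent direction stays in \<open>X\<close> because \<open>f\<close> is
  closed, whence \<open>\<parallel>\<nabla>f(x)\<parallel>\<^sup>2 \<le> 2 \<ell>(2\<parallel>\<nabla>f(x)\<parallel>) (f(x) - f\<^sup>*)\<close>: points that are no worse than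
  \<open>x\<^sub>0\<close> have gradient norm at most \<open>G\<close>. Strong convexity of \<open>\<psi>\<close> bounds a mirror descent step by
  \<open>\<eta>\<parallel>\<nabla>f(x\<^sub>t)\<parallel> \<le> G / L\<close>, so by induction the values \<open>f(x\<^sub>t)\<close> decrease, and the three-point identity
  for the Bregman function telescopes.
\<close>

section \<open>Averaging over small coordinate boxes\<close>

text \<open>A product measure is determined by its values on boxes, and the preimage of a box is a
  box of one-dimensional translates. The restriction to \<open>B\<close> keeps translated points in
  the space of the product measure, whose elements are \<open>undefined\<close> outside
  \<open>B\<close>.\<close>

lemma distr_PiM_lborel_translate:
  fixes B :: "'b set" and p :: "'b \<Rightarrow> real"
  assumes "finite B"
  shows "distr (\<Pi>\<^sub>M b\<in>B. lborel) (\<Pi>\<^sub>M b\<in>B. lborel) (\<lambda>c. \<lambda>b\<in>B. p b + c b) = (\<Pi>\<^sub>M b\<in>B. lborel)"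
    (is "distr ?P ?P ?T = _")
proof -
  interpret product_sigma_finite "\<lambda>_::'b. lborel :: real measure"
    by standard
  have T: "?T \<in> measurable ?P ?P"
    by measurable
  show ?thesis
  proof (rule PiM_eqI[OF assms])
    fix A :: "'b \<Rightarrow> real set"
    assume A: "\<And>b. b \<in> B \<Longrightarrow> A b \<in> sets lborel"
    let ?A = "\<lambda>b. (\<lambda>r. p b + r) -` A b"
    have A': "?A b \<in> sets lborel" if "b \<in> B" for b
      using measurable_sets[of "\<lambda>r. p b + r" lborel lborel "A b"] A[OF that] by simp
    have "emeasure (distr ?P ?P ?T) (Pi\<^sub>E B A) = emeasure ?P (?T -` Pi\<^sub>E B A \<inter> space ?P)"
      using A assms by (intro emeasure_distr T sets_PiM_I_finite) auto
    also have "?T -` Pi\<^sub>E B A \<inter> space ?P = Pi\<^sub>E B ?A"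
      by (auto simp: space_PiM PiE_iff)
    also have "emeasure ?P (Pi\<^sub>E B ?A) = (\<Prod>b\<in>B. emeasure lborel (?A b))"
      using A' assms by (intro emeasure_PiM)
    also have "\<dots> = (\<Prod>b\<in>B. emeasure lborel (A b))"
    proof (rule prod.cong[OF refl])
      fix b assume "b \<in> B"
      then have "emeasure (distr lborel borel ((+) (p b))) (A b) = emeasure lborel (?A b)"
        using A by (subst emeasure_distr) auto
      then show "emeasure lborel (?A b) = emeasure lborel (A b)"
        by (subst (asm) lborel_distr_plus) simp
    qed
    finally show "emeasure (distr ?P ?P ?T) (Pi\<^sub>E B A) = (\<Prod>b\<in>B. emeasure lborel (A b))" .
  qed simp
qed

text \<open>In coordinates, adding \<open>z\<close> is a shift, which preserves the measure. This
  lets an exceptional null set be viewed from any centre.\<close>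

lemma AE_PiM_lborel_translate:
  fixes B :: "'a::real_vector set"
  assumes "finite B" "span B = UNIV"
    and "AE c in (\<Pi>\<^sub>M b\<in>B. lborel). P (\<Sum>b\<in>B. c b *\<^sub>R b)"
  shows "AE c in (\<Pi>\<^sub>M b\<in>B. lborel). P (z + (\<Sum>b\<in>B. c b *\<^sub>R b))"
proof -
  have "z \<in> span B" using assms by simp
  then obtain p where p: "z = (\<Sum>b\<in>B. p b *\<^sub>R b)"
    using span_finite[OF assms(1)] by auto
  let ?T = "\<lambda>c. \<lambda>b\<in>B. p b + c b" and ?P = "\<Pi>\<^sub>M b\<in>B. (lborel :: real measure)"
  have "AE c in distr ?P ?P ?T. P (\<Sum>b\<in>B. c b *\<^sub>R b)"
    using assms(3) unfolding distr_PiM_lborel_translate[OF assms(1)] .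
  then have "AE c in ?P. P (\<Sum>b\<in>B. ?T c b *\<^sub>R b)"
    by (rule AE_distrD[rotated]) measurable
  moreover have "(\<Sum>b\<in>B. ?T c b *\<^sub>R b) = z + (\<Sum>b\<in>B. c b *\<^sub>R b)" for c
    unfolding p by (simp add: scaleR_left_distrib sum.distrib)
  ultimately show ?thesis by simp
qed

text \<open>
  The type \<open>'a\<close> is not known to be second countable, so sums of measurable functions into \<open>'a\<close>
  are not covered by the library; we factor through the countable product \<open>nat \<Rightarrow> real\<close>.
\<close>

lemma borel_measurable_linear_combination:
  fixes B :: "'a::real_normed_vector set"
  assumes "finite B"
  shows "(\<lambda>c. \<Sum>b\<in>B. c b *\<^sub>R b) \<in> borel_measurable (\<Pi>\<^sub>M b\<in>B. lborel)"
proof -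
  obtain e where e: "bij_betw e {..<card B} B"
    using ex_bij_betw_nat_finite[OF assms] by (auto simp: atLeast0LessThan)
  define k where "k c i = (if i < card B then c (e i) else 0)" for c :: "'a \<Rightarrow> real" and i
  have 1: "k \<in> borel_measurable (\<Pi>\<^sub>M b\<in>B. lborel)"
  proof (rule measurable_coordinatewise_then_product)
    fix i
    show "(\<lambda>c. k c i) \<in> borel_measurable (\<Pi>\<^sub>M b\<in>B. lborel)"
    proof (cases "i < card B")
      case True
      then have "e i \<in> B" using e by (auto simp: bij_betw_def)
      then have "(\<lambda>c. c (e i)) \<in> measurable (\<Pi>\<^sub>M b\<in>B. lborel :: real measure) lborel"
        by (rule measurable_component_singleton)
      then show ?thesis using True by (simp add: k_def)
    qed (simp add: k_def)
  qed
  have 2: "(\<lambda>u::nat \<Rightarrow> real. \<Sum>i<card B. u i *\<^sub>R e i) \<in> borel_measurable borel"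
    by (intro borel_measurable_continuous_onI continuous_intros continuous_on_product_coordinates)
  have "(\<Sum>b\<in>B. c b *\<^sub>R b) = (\<Sum>i<card B. k c i *\<^sub>R e i)" for c
    unfolding k_def using sum.reindex_bij_betw[OF e, of "\<lambda>b. c b *\<^sub>R b"] by simp
  then show ?thesis using measurable_compose[OF 1 2] by simp
qed

text \<open>\<open>N\<close> is normalized Lebesgue measure on a coordinate box. The order of
  quantifiers matters: one choice of \<open>N\<close> and \<open>\<phi>\<close> serves every centre
  \<open>z\<close>, while the null set may depend on \<open>z\<close>.\<close>

lemma almost_everywhere_on_average:
  fixes X :: "'a::real_normed_vector set"
  assumes "almost_everywhere_on X P" "\<epsilon> > 0"
  obtains N :: "('a \<Rightarrow> real) measure" and \<phi>
  where "prob_space N" "\<phi> \<in> borel_measurable N" "AE c in N. norm (\<phi> c) \<le> \<epsilon>"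
    "\<And>z. AE c in N. z + \<phi> c \<in> X \<longrightarrow> P (z + \<phi> c)"
proof -
  obtain B where B: "finite B" "span B = UNIV"
    and AE: "AE c in (\<Pi>\<^sub>M b\<in>B. lborel). (\<Sum>b\<in>B. c b *\<^sub>R b) \<in> X \<longrightarrow> P (\<Sum>b\<in>B. c b *\<^sub>R b)"
    using assms(1) unfolding almost_everywhere_on_def by blast
  interpret product_sigma_finite "\<lambda>_::'a. lborel :: real measure"
    by standard
  \<comment> \<open>Small enough for the triangle inequality to give norm at most \<epsilon>; the
    summand 1 keeps the denominator positive when the sum is zero.\<close>
  define \<rho> where "\<rho> = \<epsilon> / (1 + (\<Sum>b\<in>B. norm b))"
  have S: "(\<Sum>b\<in>B. norm b) \<ge> 0" by (rule sum_nonneg) simp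
  then have \<rho>: "\<rho> > 0" using assms(2) by (simp add: \<rho>_def)
  define P' where "P' = (\<Pi>\<^sub>M b\<in>B. (lborel :: real measure))"
  define Q where "Q = (\<Pi>\<^sub>E b\<in>B. {-\<rho>..\<rho>})"
  define \<phi> where "\<phi> c = (\<Sum>b\<in>B. c b *\<^sub>R b)" for c :: "'a \<Rightarrow> real"
  have Q: "Q \<in> sets P'"
    unfolding Q_def P'_def using B by (intro sets_PiM_I_finite) auto
  \<comment> \<open>The value is positive and finite, as normalizing the measure on \<open>Q\<close>
    requires.\<close>
  have "emeasure P' Q = (\<Prod>b\<in>B. emeasure lborel {-\<rho>..\<rho>})"
    unfolding Q_def P'_def using B by (intro emeasure_PiM) auto
  also have "\<dots> = (\<Prod>b\<in>B. ennreal (2 * \<rho>))"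
    using \<rho> by simp
  also have "\<dots> = ennreal ((2 * \<rho>) ^ card B)"
    using \<rho> by (simp add: ennreal_power)
  finally have eQ: "emeasure P' Q = ennreal ((2 * \<rho>) ^ card B)" .
  have norm_le: "norm (\<phi> c) \<le> \<epsilon>" if "c \<in> Q" for c
  proof -
    have "norm (\<phi> c) \<le> (\<Sum>b\<in>B. \<rho> * norm b)"
      unfolding \<phi>_def
    proof (rule sum_norm_le)
      fix b assume "b \<in> B"
      then have "\<bar>c b\<bar> \<le> \<rho>" using that by (force simp: Q_def PiE_iff)
      then show "norm (c b *\<^sub>R b) \<le> \<rho> * norm b"
        by (simp add: mult_right_mono)
    qed
    also have "\<dots> = \<rho> * (\<Sum>b\<in>B. norm b)" by (simp add: sum_distrib_left)
    also have "\<dots> \<le> \<epsilon>" using S assms(2) by (simp add: \<rho>_def field_simps)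
    finally show ?thesis .
  qed
  show thesis
  proof
    show "prob_space (uniform_measure P' Q)"
      using eQ \<rho> by (intro prob_space_uniform_measure) auto
    have "\<phi> \<in> borel_measurable P'"
      unfolding P'_def \<phi>_def using B(1) by (rule borel_measurable_linear_combination)
    then show "\<phi> \<in> borel_measurable (uniform_measure P' Q)"
      unfolding measurable_cong_sets[OF sets_uniform_measure refl] .
    show "AE c in uniform_measure P' Q. norm (\<phi> c) \<le> \<epsilon>"
      using Q norm_le by (intro AE_uniform_measureI) auto
    fix z
    have "AE c in P'. z + \<phi> c \<in> X \<longrightarrow> P (z + \<phi> c)"
      unfolding P'_def \<phi>_def
      using AE_PiM_lborel_translate[OF B, where P = "\<lambda>w. w \<in> X \<longrightarrow> P w"] AE by blast
    then show "AE c in uniform_measure P' Q. z + \<phi> c \<in> X \<longrightarrow> P (z + \<phi> c)"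
      using Q by (intro AE_uniform_measureI) auto
  qed
qed

section \<open>From an almost everywhere derivative bound to increments\<close>

text \<open>The derivative bound may fail everywhere on the segment itself, so it cannot be
  integrated there. Instead the mean of \<open>F\<close> over random translates of the segment is
  estimated; at each endpoint the mean differs from \<open>F\<close> by at most
  \<open>K * \<epsilon>\<close>.\<close>

lemma averaged_directional_derivative_bound:
  fixes F :: "'a::real_normed_vector \<Rightarrow> real"
  assumes N: "prob_space N" and \<phi>[measurable]: "\<phi> \<in> borel_measurable N"
    and small: "AE c in N. norm (\<phi> c) \<le> \<epsilon>"
    and S: "open S" and F: "K-lipschitz_on S F"
    and seg: "\<And>s. s \<in> {0..1} \<Longrightarrow> cball (w + s *\<^sub>R d) \<epsilon> \<subseteq> S"
    and der: "\<And>z. AE c in N. z + \<phi> c \<in> S \<longrightarrow>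
      (\<exists>H. (F has_derivative H) (at (z + \<phi> c)) \<and> \<bar>H d\<bar> \<le> m)"
    and m: "0 \<le> m" and \<epsilon>: "0 \<le> \<epsilon>"
  shows "\<bar>F (w + d) - F w\<bar> \<le> m + 2 * K * \<epsilon>"
proof -
  interpret prob_space N by (rule N)
  have K: "0 \<le> K" using F by (rule lipschitz_on_nonneg)
  \<comment> \<open>Cutting off outside the open set \<open>S\<close> gives a Borel function on the
    whole space, since \<open>F\<close> is only known to be continuous on \<open>S\<close>.\<close>
  define F0 where "F0 z = indicator S z *\<^sub>R F z" for z
  define p where "p s = w + s *\<^sub>R d" for s
  define q where "q s c = F0 (p s + \<phi> c)" for s c
  have F0[measurable]: "F0 \<in> borel_measurable borel"
    unfolding F0_def using S F
    by (intro borel_measurable_continuous_on_indicator lipschitz_on_continuous_on) auto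
  have q_meas[measurable]: "q s \<in> borel_measurable N" for s
  proof -
    have "(\<lambda>z. p s + z) \<in> borel_measurable borel"
      by (intro borel_measurable_continuous_onI continuous_intros)
    from measurable_compose[OF \<phi> measurable_compose[OF this F0]] show ?thesis
      by (simp add: q_def[abs_def])
  qed
  have inS: "AE c in N. p s + \<phi> c \<in> S" if "s \<in> {0..1}" for s
    using small
  proof eventually_elim
    case (elim c)
    then have "p s + \<phi> c \<in> cball (p s) \<epsilon>" by (simp add: dist_norm)
    then show ?case using seg[OF that] by (auto simp: p_def)
  qed
  have q_near: "AE c in N. \<bar>q s c - F (p s)\<bar> \<le> K * \<epsilon>" if "s \<in> {0..1}" for s
    using inS[OF that] small
  proof eventually_elim
    case (elim c)
    have "p s \<in> S" using seg[OF that] \<epsilon> by (auto simp: p_def)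
    then have "dist (F (p s + \<phi> c)) (F (p s)) \<le> K * dist (p s + \<phi> c) (p s)"
      using elim by (intro lipschitz_onD[OF F]) auto
    also have "\<dots> \<le> K * \<epsilon>" using elim K by (simp add: dist_norm mult_left_mono)
    finally show ?case using elim by (simp add: q_def F0_def dist_real_def)
  qed
  have q_int[simp]: "integrable N (q s)" if "s \<in> {0..1}" for s
  proof (rule integrable_const_bound)
    show "AE c in N. norm (q s c) \<le> \<bar>F (p s)\<bar> + K * \<epsilon>"
      using q_near[OF that] by eventually_elim auto
  qed measurable
  have q_lip: "AE c in N. \<bar>q s c - q t c\<bar> \<le> K * norm d * \<bar>s - t\<bar>"
    if "s \<in> {0..1}" "t \<in> {0..1}" for s t
    using inS[OF that(1)] inS[OF that(2)]
  proof eventually_elim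
    case (elim c)
    have "dist (F (p s + \<phi> c)) (F (p t + \<phi> c)) \<le> K * dist (p s + \<phi> c) (p t + \<phi> c)"
      using elim by (intro lipschitz_onD[OF F])
    also have "dist (p s + \<phi> c) (p t + \<phi> c) = \<bar>s - t\<bar> * norm d"
      by (simp add: p_def dist_norm flip: scaleR_diff_left)
    finally show ?case using elim by (simp add: q_def F0_def dist_real_def mult_ac)
  qed
  define A where "A s = expectation (q s)" for s
  have A_le: "\<bar>A s - A t\<bar> \<le> expectation (\<lambda>c. \<bar>q s c - q t c\<bar>)"
    if "s \<in> {0..1}" "t \<in> {0..1}" for s t
  proof -
    have "A s - A t = expectation (\<lambda>c. q s c - q t c)" using that by (simp add: A_def)
    then show ?thesis using integral_abs_bound[of N "\<lambda>c. q s c - q t c"] by simp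
  qed
  have A_lip: "(K * norm d)-lipschitz_on {0..1} A"
  proof (rule lipschitz_onI)
    fix s t :: real assume st: "s \<in> {0..1}" "t \<in> {0..1}"
    have "expectation (\<lambda>c. \<bar>q s c - q t c\<bar>) \<le> expectation (\<lambda>c. K * norm d * \<bar>s - t\<bar>)"
      using st q_lip[OF st] by (intro integral_mono_AE) auto
    then show "dist (A s) (A t) \<le> K * norm d * dist s t"
      using A_le[OF st] by (simp add: dist_real_def prob_space)
  qed (use K in simp)
  \<comment> \<open>The slack between \<open>m\<close> and \<open>m'\<close> turns a limit into a
    strict inequality for some step. One such step to the right of every point suffices for
    \<open>locally_lipschitz_imp_lipschitz\<close>; afterwards \<open>m'\<close> decreases to
    \<open>m\<close>.\<close>
  have "\<bar>A 1 - A 0\<bar> \<le> m'" if "m < m'" for m'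
  proof -
    have "m'-lipschitz_on {0..1} A"
    proof (rule locally_lipschitz_imp_lipschitz)
      show "continuous_on {0..1} A" using A_lip by (rule lipschitz_on_continuous_on)
      show "0 \<le> m'" using that m by simp
      fix x y :: real assume x: "x \<in> {0..<1}" and y: "x < y"
      define h where "h n = (min 1 y - x) / real (Suc n)" for n
      have h: "0 < h n" "h n \<le> min 1 y - x" for n
      proof -
        have pos: "0 < min 1 y - x" using x y by auto
        then show "0 < h n" by (simp add: h_def)
        show "h n \<le> min 1 y - x"
          unfolding h_def using pos by (auto simp: divide_le_eq ring_distribs intro!: mult_right_mono)
      qed
      have h_lim: "h \<longlonglongrightarrow> 0"
        unfolding h_def[abs_def] by (intro LIMSEQ_Suc[OF lim_const_over_n])
      have xh: "x + h n \<in> {0..1}" "x \<in> {0..1}" for n using h[of n] x by auto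
      \<comment> \<open>The quotients converge to a value that depends on \<open>c\<close> and is
        only bounded by \<open>m\<close>. The maximum with \<open>m\<close> makes the pointwise
        limit constant, so no measurable choice of derivatives enters the dominated convergence
        argument.\<close>
      define Q where "Q n c = max (\<bar>q (x + h n) c - q x c\<bar> / h n) m" for n c
      have "(\<lambda>n. expectation (Q n)) \<longlonglongrightarrow> expectation (\<lambda>c. m)"
      proof (rule integral_dominated_convergence[where w = "\<lambda>_. K * norm d + m"])
        show "Q n \<in> borel_measurable N" for n unfolding Q_def by measurable
        show "AE c in N. norm (Q n c) \<le> K * norm d + m" for n
          using q_lip[OF xh(1)[of n] xh(2)]
        proof eventually_elim
          case (elim c)
          then have "\<bar>q (x + h n) c - q x c\<bar> / h n \<le> K * norm d"
            using h[of n] by (simp add: field_simps)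
          then show ?case unfolding Q_def using m K by (simp add: max_def)
        qed
        \<comment> \<open>Only countably many points are sampled, so a single null set serves for
          all of them.\<close>
        have "AE c in N. \<forall>n. p (x + h n) + \<phi> c \<in> S"
          using inS[OF xh(1)] by (simp add: AE_all_countable)
        then show "AE c in N. (\<lambda>n. Q n c) \<longlonglongrightarrow> m"
          using inS[OF xh(2)] der[of "p x"]
        proof eventually_elim
          case (elim c)
          then obtain H where H: "(F has_derivative H) (at (p x + \<phi> c))" "\<bar>H d\<bar> \<le> m" by blast
          have "((\<lambda>t. F ((p x + \<phi> c) + t *\<^sub>R d)) has_derivative (\<lambda>t. H (t *\<^sub>R d))) (at 0)"
            by (rule has_derivative_compose[where g = F]) (auto intro!: derivative_eq_intros H)
          then have "((\<lambda>t. F ((p x + \<phi> c) + t *\<^sub>R d)) has_field_derivative H d) (at 0)"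
            using has_derivative_linear[OF H(1)]
            by (simp add: has_field_derivative_def linear_scale mult.commute[of _ "H d"])
          then have "(\<lambda>t. (F ((p x + \<phi> c) + t *\<^sub>R d) - F (p x + \<phi> c)) / t) \<midarrow>0\<rightarrow> H d"
            by (simp add: DERIV_def)
          moreover have "filterlim h (at 0) sequentially"
            using h_lim h(1) by (auto simp: filterlim_at less_imp_neq[symmetric] order_less_imp_not_eq2)
          ultimately have "(\<lambda>n. (F ((p x + \<phi> c) + h n *\<^sub>R d) - F (p x + \<phi> c)) / h n) \<longlonglongrightarrow> H d"
            by (rule filterlim_compose)
          moreover have "(F ((p x + \<phi> c) + h n *\<^sub>R d) - F (p x + \<phi> c)) = q (x + h n) c - q x c" for n
            using elim by (simp add: q_def F0_def p_def scaleR_left_distrib add_ac)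
          ultimately have "(\<lambda>n. (q (x + h n) c - q x c) / h n) \<longlonglongrightarrow> H d" by simp
          then have "(\<lambda>n. max \<bar>(q (x + h n) c - q x c) / h n\<bar> m) \<longlonglongrightarrow> max \<bar>H d\<bar> m"
            by (intro tendsto_max tendsto_rabs tendsto_const)
          then show ?case using H(2) by (simp add: Q_def abs_of_pos[OF h(1)] max_absorb2)
        qed
      qed auto
      then have "(\<lambda>n. expectation (Q n)) \<longlonglongrightarrow> m" by (simp add: prob_space)
      then have "\<forall>\<^sub>F n in sequentially. expectation (Q n) < m'" using that by (rule order_tendstoD)
      then obtain n where n: "expectation (Q n) < m'" by (auto simp: eventually_sequentially)
      have Q_int: "integrable N (Q n)"
        unfolding Q_def using xh(1)[of n] xh(2) by (intro integrable_max) auto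
      have "\<bar>A (x + h n) - A x\<bar> \<le> expectation (\<lambda>c. \<bar>q (x + h n) c - q x c\<bar>)"
        by (rule A_le[OF xh])
      also have "\<dots> \<le> expectation (\<lambda>c. h n * Q n c)"
      proof (rule integral_mono)
        show "\<bar>q (x + h n) c - q x c\<bar> \<le> h n * Q n c" for c
          using h(1)[of n] by (simp add: Q_def max_def field_simps)
      qed (use xh(1)[of n] xh(2) Q_int in auto)
      also have "\<dots> = h n * expectation (Q n)" by simp
      also have "\<dots> \<le> m' * h n" using n h(1)[of n] by (simp add: mult.commute)
      finally show "\<exists>z\<in>{x<..y}. dist (A z) (A x) \<le> m' * (z - x)"
        using h[of n] by (intro bexI[of _ "x + h n"]) (auto simp: dist_real_def)
    qed
    from lipschitz_onD[OF this, of 1 0] show ?thesis by (simp add: dist_real_def)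
  qed
  then have A10: "\<bar>A 1 - A 0\<bar> \<le> m" by (rule dense_ge)
  have "\<bar>A s - F (p s)\<bar> \<le> K * \<epsilon>" if s: "s \<in> {0..1}" for s
  proof -
    have "A s - F (p s) = expectation (\<lambda>c. q s c - F (p s))"
      using s by (simp add: A_def prob_space)
    also have "\<bar>\<dots>\<bar> \<le> expectation (\<lambda>c. \<bar>q s c - F (p s)\<bar>)"
      by (rule integral_abs_bound)
    also have "\<dots> \<le> expectation (\<lambda>c. K * \<epsilon>)"
      using s q_near[OF s] by (intro integral_mono_AE) auto
    finally show ?thesis by (simp add: prob_space)
  qed
  from this[of 0] this[of 1] A10 show ?thesis
    by (simp add: p_def abs_le_iff algebra_simps)
qed

section \<open>Derivatives along segments\<close>

lemma dgrad_has_derivative: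
  "f differentiable (at x) \<Longrightarrow> (f has_derivative blinfun_apply (dgrad f x)) (at x)"
  by (metis dgrad_def frechet_derivative_works has_derivative_bounded_linear
      bounded_linear_Blinfun_apply)

lemma has_derivative_along_line:
  fixes f :: "'a::real_normed_vector \<Rightarrow> real"
  assumes "f differentiable (at (x + s *\<^sub>R d))"
  shows "((\<lambda>s. f (x + s *\<^sub>R d)) has_field_derivative dgrad f (x + s *\<^sub>R d) d) (at s)"
proof -
  have "((\<lambda>s. f (x + s *\<^sub>R d)) has_derivative (\<lambda>t. dgrad f (x + s *\<^sub>R d) (t *\<^sub>R d))) (at s)"
    by (rule has_derivative_compose[where g = f])
      (auto intro!: derivative_eq_intros dgrad_has_derivative assms)
  then show ?thesis
    by (simp add: has_field_derivative_def blinfun.scaleR_right mult.commute[of _ "blinfun_apply _ d"])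
qed

lemma segment_in_convex:
  fixes X :: "'a::real_vector set"
  assumes "convex X" "x \<in> X" "x + d \<in> X" "s \<in> {0..1::real}"
  shows "x + s *\<^sub>R d \<in> X"
proof -
  have "(1 - s) *\<^sub>R x + s *\<^sub>R (x + d) \<in> X"
    using assms by (intro convexD) auto
  then show ?thesis by (simp add: algebra_simps)
qed

lemma convex_on_dgrad_le:
  fixes f :: "'a::real_normed_vector \<Rightarrow> real"
  assumes "convex_on X f" "x \<in> X" "y \<in> X" "f differentiable (at x)"
  shows "f x + dgrad f x (y - x) \<le> f y"
proof -
  let ?q = "\<lambda>t. (f (x + t *\<^sub>R (y - x)) - f x) / t"
  have "(?q \<longlongrightarrow> dgrad f x (y - x)) (at 0)"
    using has_derivative_along_line[of f x 0 "y - x"] assms(4) by (simp add: DERIV_def)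
  then have "(?q \<longlongrightarrow> dgrad f x (y - x)) (at_right 0)"
    by (rule tendsto_mono[rotated]) (simp add: at_le)
  moreover have "\<forall>\<^sub>F t in at_right (0::real). ?q t \<le> f y - f x"
    unfolding eventually_at_right_field
  proof (intro exI[of _ 1] conjI allI impI)
    fix t :: real assume t: "0 < t" "t < 1"
    have "f ((1 - t) *\<^sub>R x + t *\<^sub>R y) \<le> (1 - t) * f x + t * f y"
      using t assms by (intro convex_onD) auto
    then have "f (x + t *\<^sub>R (y - x)) \<le> (1 - t) * f x + t * f y"
      by (simp add: algebra_simps)
    then show "?q t \<le> f y - f x" using t by (simp add: field_simps)
  qed simp
  ultimately have "dgrad f x (y - x) \<le> f y - f x"
    by (rule tendsto_upperbound) simp
  then show ?thesis by simp
qed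

section \<open>Gradient estimates for \<open>ell\<close>-smooth functions\<close>

locale ell_smooth =
  fixes X :: "'a::real_normed_vector set" and f :: "'a \<Rightarrow> real" and ell :: "real \<Rightarrow> real"
  assumes X_open: "open X" and X_convex: "convex X"
    and ell_pos: "\<And>\<alpha>. 0 \<le> \<alpha> \<Longrightarrow> 0 < ell \<alpha>"
    and ell_mono: "mono_on {0..} ell"
    and f_smooth: "f \<in> ell_smooth_class ell X"
begin

lemma f_differentiable: "x \<in> X \<Longrightarrow> f differentiable (at x)"
  using f_smooth by (simp add: ell_smooth_class_def)

lemma dgrad_ball_lipschitz:
  assumes "x \<in> X"
  obtains r K where "0 < r" "ball x r \<subseteq> X" "K-lipschitz_on (ball x r) (dgrad f)"
proof -
  obtain r1 K where 1: "0 < r1" "K-lipschitz_on (ball x r1 \<inter> X) (dgrad f)"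
    using f_smooth assms unfolding ell_smooth_class_def by blast
  obtain r2 where 2: "0 < r2" "ball x r2 \<subseteq> X"
    using X_open assms open_contains_ball by blast
  show thesis
  proof
    show "K-lipschitz_on (ball x (min r1 r2)) (dgrad f)"
      using 2 by (intro lipschitz_on_subset[OF 1(2)]) (auto simp: subset_iff)
  qed (use 1 2 in \<open>auto simp: subset_iff\<close>)
qed

lemma dgrad_continuous_on: "continuous_on X (dgrad f)"
proof (rule continuous_at_imp_continuous_on, rule ballI)
  fix x assume "x \<in> X"
  then obtain r K where "0 < r" "K-lipschitz_on (ball x r) (dgrad f)"
    using dgrad_ball_lipschitz by metis
  then show "isCont (dgrad f) x"
    using lipschitz_on_continuous_on continuous_on_interior[of "ball x r" "dgrad f" x] by auto
qed

text \<open>By continuity the gradient norm stays below \<open>C\<close> near \<open>x\<close>, so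
  monotonicity of \<open>ell\<close> bounds the Hessian by \<open>ell C\<close> almost everywhere
  there. Averaging converts this into a bound on every increment, up to an error proportional to
  \<epsilon>.\<close>

lemma dgrad_ball_lipschitz_ell:
  assumes x: "x \<in> X" and C: "norm (dgrad f x) < C"
  obtains r where "0 < r" "ball x r \<subseteq> X" "(ell C)-lipschitz_on (ball x r) (dgrad f)"
proof -
  have C0: "0 < C" using C norm_ge_zero[of "dgrad f x"] by linarith
  obtain r1 K where r1: "0 < r1" "ball x r1 \<subseteq> X" "K-lipschitz_on (ball x r1) (dgrad f)"
    using dgrad_ball_lipschitz[OF x] by blast
  have "isCont (\<lambda>z. norm (dgrad f z)) x"
    using dgrad_continuous_on X_open x by (intro continuous_norm) (auto simp: continuous_on_eq_continuous_at)
  then have "((\<lambda>z. norm (dgrad f z)) \<longlongrightarrow> norm (dgrad f x)) (nhds x)"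
    unfolding isCont_def
    by (rule tendsto_at_iff_tendsto_nhds[THEN iffD1, of "\<lambda>z. norm (dgrad f z)"])
  from order_tendstoD(2)[OF this C] have "\<forall>\<^sub>F z in nhds x. norm (dgrad f z) < C" .
  then obtain r2 where r2: "0 < r2" "\<And>z. z \<in> ball x r2 \<Longrightarrow> norm (dgrad f z) < C"
    unfolding eventually_nhds_metric by (auto simp: dist_commute)
  define R where "R = min r1 r2"
  have R: "0 < R" "ball x R \<subseteq> X" "K-lipschitz_on (ball x R) (dgrad f)"
    "\<And>z. z \<in> ball x R \<Longrightarrow> norm (dgrad f z) < C"
    using r1 r2 by (auto simp: R_def subset_iff intro: lipschitz_on_subset)
  have K: "0 \<le> K" using R(3) by (rule lipschitz_on_nonneg)
  \<comment> \<open>The half radius leaves room for perturbations: a segment in the small ball,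
    moved by less than \<open>R / 2\<close>, stays in the ball of radius \<open>R\<close>.\<close>
  have "(ell C)-lipschitz_on (ball x (R / 2)) (dgrad f)"
  proof (rule lipschitz_onI)
    show "0 \<le> ell C" using ell_pos[of C] C0 by simp
    fix y w assume y: "y \<in> ball x (R / 2)" and w: "w \<in> ball x (R / 2)"
    define d where "d = y - w"
    have "norm (blinfun_apply (dgrad f y - dgrad f w) v) \<le> (ell C * norm d) * norm v" for v
    proof -
      \<comment> \<open>Averaging concerns real functions, so the gradient is tested against a fixed
        vector \<open>v\<close>; the operator norm is recovered at the end.\<close>
      define F where "F z = dgrad f z v" for z
      have F: "(K * norm v)-lipschitz_on (ball x R) F"
      proof (rule lipschitz_onI)
        fix z z' assume zz: "z \<in> ball x R" "z' \<in> ball x R"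
        have "\<bar>F z - F z'\<bar> \<le> norm (dgrad f z - dgrad f z') * norm v"
          using norm_blinfun[of "dgrad f z - dgrad f z'" v] by (simp add: F_def blinfun.diff_left)
        also have "\<dots> \<le> (K * dist z z') * norm v"
          using lipschitz_onD[OF R(3) zz] by (intro mult_right_mono) (auto simp: dist_norm)
        finally show "dist (F z) (F z') \<le> K * norm v * dist z z'"
          by (simp add: dist_real_def mult_ac)
      qed (use K in simp)
      have bound: "\<bar>F y - F w\<bar> \<le> ell C * norm d * norm v + 2 * (K * norm v) * \<epsilon>"
        if \<epsilon>: "0 < \<epsilon>" "\<epsilon> < R / 2" for \<epsilon>
      proof -
        have "almost_everywhere_on X (\<lambda>x. \<exists>H. (dgrad f has_derivative H) (at x) \<and>
            (\<forall>h. norm (H h) \<le> ell (norm (dgrad f x)) * norm h))" (is "almost_everywhere_on X ?P")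
          using f_smooth by (simp add: ell_smooth_class_def)
        then obtain N :: "('a \<Rightarrow> real) measure" and \<phi> where N: "prob_space N" "\<phi> \<in> borel_measurable N"
            "AE c in N. norm (\<phi> c) \<le> \<epsilon>"
            "\<And>z. AE c in N. z + \<phi> c \<in> X \<longrightarrow> ?P (z + \<phi> c)"
          using almost_everywhere_on_average \<epsilon>(1) by blast
        have "\<bar>F (w + d) - F w\<bar> \<le> ell C * norm d * norm v + 2 * (K * norm v) * \<epsilon>"
        proof (rule averaged_directional_derivative_bound[OF N(1-3) open_ball F])
          fix s :: real assume "s \<in> {0..1}"
          then have "w + s *\<^sub>R d \<in> ball x (R / 2)"
            using y w by (intro segment_in_convex) (auto simp: d_def)
          then show "cball (w + s *\<^sub>R d) \<epsilon> \<subseteq> ball x R"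
          proof (intro subsetI)
            fix u assume "u \<in> cball (w + s *\<^sub>R d) \<epsilon>"
            with \<open>w + s *\<^sub>R d \<in> ball x (R / 2)\<close> show "u \<in> ball x R"
              using \<epsilon> dist_triangle[of x u "w + s *\<^sub>R d"] by simp
          qed
        next
          fix z
          show "AE c in N. z + \<phi> c \<in> ball x R \<longrightarrow>
              (\<exists>H. (F has_derivative H) (at (z + \<phi> c)) \<and> \<bar>H d\<bar> \<le> ell C * norm d * norm v)"
            using N(4)[of z]
          proof eventually_elim
            case (elim c)
            show ?case
            proof
              assume zc: "z + \<phi> c \<in> ball x R"
              then obtain H where H: "(dgrad f has_derivative H) (at (z + \<phi> c))"
                "\<And>h. norm (H h) \<le> ell (norm (dgrad f (z + \<phi> c))) * norm h"
                using elim R(2) by blast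
              have "ell (norm (dgrad f (z + \<phi> c))) \<le> ell C"
                using R(4)[OF zc] C0 by (intro mono_onD[OF ell_mono]) auto
              then have "norm (H d) \<le> ell C * norm d"
                using H(2)[of d] by (meson mult_right_mono norm_ge_zero order_trans)
              then have "\<bar>blinfun_apply (H d) v\<bar> \<le> ell C * norm d * norm v"
                using norm_blinfun[of "H d" v] mult_right_mono[of "norm (H d)" "ell C * norm d" "norm v"] by simp
              moreover have "(F has_derivative (\<lambda>h. blinfun_apply (H h) v)) (at (z + \<phi> c))"
                unfolding F_def by (rule bounded_linear.has_derivative[OF blinfun.bounded_linear_left H(1)])
              ultimately show "\<exists>H. (F has_derivative H) (at (z + \<phi> c)) \<and> \<bar>H d\<bar> \<le> ell C * norm d * norm v"
                by blast
            qed
          qed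
        qed (use \<epsilon> ell_pos[of C] C0 in auto)
        then show ?thesis by (simp add: d_def)
      qed
      \<comment> \<open>The uncontrolled constant \<open>K\<close> occurs only in the error term,
        which vanishes with \<epsilon>.\<close>
      have "((\<lambda>\<epsilon>. ell C * norm d * norm v + 2 * (K * norm v) * \<epsilon>) \<longlongrightarrow>
          ell C * norm d * norm v + 2 * (K * norm v) * 0) (at_right 0)"
        by (intro tendsto_intros)
      moreover have "\<forall>\<^sub>F \<epsilon> in at_right 0. \<bar>F y - F w\<bar> \<le> ell C * norm d * norm v + 2 * (K * norm v) * \<epsilon>"
        unfolding eventually_at_right_field using bound R(1) by (intro exI[of _ "R / 2"]) auto
      ultimately have "\<bar>F y - F w\<bar> \<le> ell C * norm d * norm v + 2 * (K * norm v) * 0"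
        by (rule tendsto_lowerbound) simp
      then show ?thesis by (simp add: F_def blinfun.diff_left)
    qed
    then have "norm (dgrad f y - dgrad f w) \<le> ell C * norm d"
      using ell_pos[of C] C0 by (intro norm_blinfun_bound) auto
    then show "dist (dgrad f y) (dgrad f w) \<le> ell C * dist y w"
      by (simp add: dist_norm d_def)
  qed
  then show thesis using R(1,2) by (intro that[of "R / 2"]) (auto simp: subset_iff)
qed

text \<open>
  Bootstrapping: up to the first point where the gradient norm reaches \<open>2 * G\<close>, the gradient moves
  at speed at most \<open>ell (2 * G) * norm d \<le> G\<close>, so that point cannot come before the end of the
  segment.
\<close>

lemma dgrad_segment_lipschitz:
  assumes x: "x \<in> X" "x + d \<in> X" and G: "norm (dgrad f x) \<le> G" "0 < G"
    and d: "ell (2 * G) * norm d \<le> G" and t: "t \<in> {0..1}"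
  shows "norm (dgrad f (x + t *\<^sub>R d) - dgrad f x) \<le> ell (2 * G) * norm d * t"
proof -
  define p where "p s = x + s *\<^sub>R d" for s :: real
  define F where "F s = dgrad f (p s)" for s
  have pX: "p s \<in> X" if "s \<in> {0..1}" for s
    unfolding p_def using X_convex x that by (rule segment_in_convex)
  have F_cont: "continuous_on {0..1} F"
    unfolding F_def
    by (rule continuous_on_compose2[OF dgrad_continuous_on])
      (auto simp: p_def[abs_def] intro!: continuous_intros pX[unfolded p_def])
  define M where "M = ell (2 * G) * norm d"
  have L: "0 < ell (2 * G)" using ell_pos[of "2 * G"] G(2) by simp
  then have M: "0 \<le> M" by (simp add: M_def)
  \<comment> \<open>The gradient norm has to be controlled only strictly before \<open>t\<close>, so
    the estimate applies at the first bad time as well as at \<open>t = 1\<close>.\<close>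
  have step: "norm (F t - F 0) \<le> M * t"
    if t: "t \<in> {0..1}" and small: "\<And>s. s \<in> {0..<t} \<Longrightarrow> norm (F s) < 2 * G" for t
  proof -
    have "M-lipschitz_on {0..t} F"
    proof (rule locally_lipschitz_imp_lipschitz[OF _ _ M])
      show "continuous_on {0..t} F"
        using t by (intro continuous_on_subset[OF F_cont]) auto
      fix s u :: real assume s: "s \<in> {0..<t}" and u: "s < u"
      obtain r where r: "0 < r" "(ell (2 * G))-lipschitz_on (ball (p s) r) (dgrad f)"
        using dgrad_ball_lipschitz_ell[of "p s" "2 * G"] small[OF s] pX[of s] s t
        unfolding F_def by auto
      \<comment> \<open>The added 1 keeps \<open>k\<close> positive when \<open>d = 0\<close>; the
        factor 2 in \<open>h\<close> puts the new point strictly inside the ball.\<close>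
      define k where "k = norm d + 1"
      define h where "h = min (u - s) (r / (2 * k))"
      have n: "0 < k" by (simp add: k_def add_nonneg_pos)
      have h: "0 < h" "h \<le> u - s" using u r n by (auto simp: h_def)
      have pd: "dist (p (s + h)) (p s) = h * norm d"
        using h by (simp add: p_def dist_norm scaleR_left_distrib)
      have "h * norm d \<le> h * k" using h by (simp add: k_def)
      also have "\<dots> \<le> r / (2 * k) * k"
        using n by (intro mult_right_mono) (auto simp: h_def)
      also have "\<dots> < r" using r n by simp
      finally have "p (s + h) \<in> ball (p s) r" using pd by (simp add: dist_commute)
      then have "dist (F (s + h)) (F s) \<le> ell (2 * G) * dist (p (s + h)) (p s)"
        unfolding F_def using r(1) by (intro lipschitz_onD[OF r(2)]) auto
      then show "\<exists>z\<in>{s<..u}. dist (F z) (F s) \<le> M * (z - s)"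
        using h pd by (intro bexI[of _ "s + h"]) (auto simp: M_def mult_ac)
    qed
    from lipschitz_onD[OF this, of t 0] t show ?thesis by (simp add: dist_norm)
  qed
  have F0: "norm (F 0) \<le> G" using G by (simp add: F_def p_def)
  \<comment> \<open>The endpoint is excluded because strictness comes from
    \<open>G * t0 < G\<close>, which needs \<open>t0 < 1\<close>.\<close>
  have good: "norm (F s) < 2 * G" if s: "s \<in> {0..<1}" for s
  proof (rule ccontr)
    assume "\<not> norm (F s) < 2 * G"
    define Bad where "Bad = {s \<in> {0..1}. 2 * G \<le> norm (F s)}"
    have "closed Bad"
      unfolding Bad_def using F_cont
      by (intro continuous_on_closed_Collect_le continuous_on_norm continuous_on_const) auto
    moreover have "bounded Bad" by (rule bounded_subset[of "{0..1::real}"]) (auto simp: Bad_def)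
    ultimately have "compact Bad" by (simp add: compact_eq_bounded_closed)
    moreover have sB: "s \<in> Bad" using s \<open>\<not> norm (F s) < 2 * G\<close> by (auto simp: Bad_def)
    ultimately obtain t0 where t0: "t0 \<in> Bad" "\<And>u. u \<in> Bad \<Longrightarrow> t0 \<le> u"
      using compact_attains_inf[of Bad] by blast
    have t01: "t0 \<in> {0..1}" "t0 < 1" using t0(1) t0(2)[OF sB] s by (auto simp: Bad_def)
    have "norm (F t0 - F 0) \<le> M * t0"
    proof (rule step[OF t01(1)])
      fix u assume "u \<in> {0..<t0}"
      then show "norm (F u) < 2 * G" using t0(2)[of u] t01 by (force simp: Bad_def)
    qed
    moreover have "M * t0 \<le> G * t0" using t01 d by (simp add: M_def mult_right_mono)
    moreover have "G * t0 < G" using t01 G by simp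
    moreover have "norm (F t0) \<le> norm (F t0 - F 0) + norm (F 0)"
      using norm_triangle_ineq[of "F t0 - F 0" "F 0"] by simp
    ultimately show False using F0 t0(1) by (simp add: Bad_def)
  qed
  have "norm (F t - F 0) \<le> M * t" using t good by (intro step) auto
  then show ?thesis by (simp add: F_def M_def p_def)
qed

text \<open>The quadratic model minus \<open>f\<close> is nondecreasing along the segment, since
  \<open>dgrad_segment_lipschitz\<close> makes its derivative nonnegative; the claim compares the
  endpoints.\<close>

lemma descent_inequality:
  assumes x: "x \<in> X" "x + d \<in> X" and G: "norm (dgrad f x) \<le> G" "0 < G"
    and d: "ell (2 * G) * norm d \<le> G"
  shows "f (x + d) \<le> f x + dgrad f x d + ell (2 * G) / 2 * (norm d)\<^sup>2"
proof -
  define L where "L = ell (2 * G)"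
  define g where "g = dgrad f x d"
  let ?\<theta> = "\<lambda>s. s * g + L / 2 * s\<^sup>2 * (norm d)\<^sup>2 - f (x + s *\<^sub>R d)"
  have "?\<theta> 0 \<le> ?\<theta> 1"
  proof (rule DERIV_nonneg_imp_nondecreasing[where f = ?\<theta>])
    fix s :: real assume s: "0 \<le> s" "s \<le> 1"
    have sX: "x + s *\<^sub>R d \<in> X" using X_convex x s by (intro segment_in_convex) auto
    have "(?\<theta> has_field_derivative
        (g + L * s * (norm d)\<^sup>2 - dgrad f (x + s *\<^sub>R d) d)) (at s)"
      by (auto intro!: derivative_eq_intros has_derivative_along_line f_differentiable[OF sX])
    moreover have "dgrad f (x + s *\<^sub>R d) d - g \<le> L * s * (norm d)\<^sup>2"
    proof -
      have "dgrad f (x + s *\<^sub>R d) d - g = blinfun_apply (dgrad f (x + s *\<^sub>R d) - dgrad f x) d"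
        by (simp add: g_def blinfun.diff_left)
      also have "\<dots> \<le> norm (dgrad f (x + s *\<^sub>R d) - dgrad f x) * norm d"
        using norm_blinfun[of "dgrad f (x + s *\<^sub>R d) - dgrad f x" d] by simp
      also have "\<dots> \<le> L * norm d * s * norm d"
        unfolding L_def using dgrad_segment_lipschitz[OF assms, of s] s
        by (intro mult_right_mono) auto
      finally show ?thesis by (simp add: power2_eq_square mult_ac)
    qed
    ultimately show "\<exists>y. (?\<theta> has_field_derivative y) (at s) \<and> 0 \<le> y" by force
  qed simp
  then show ?thesis by (simp add: L_def g_def)
qed

text \<open>With \<open>G\<close> the gradient norm and \<open>L = ell (2 * G)\<close>, a step of
  length about \<open>G / L\<close> in a direction of nearly steepest descent lowers
  \<open>f\<close> by nearly \<open>G\<^sup>2 / (2 * L)\<close>, and the value reached is still at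
  least \<open>m\<close>.\<close>

lemma dgrad_self_bound:
  assumes closed: "\<And>a. closed {z \<in> X. f z \<le> a}"
    and lower: "\<And>z. z \<in> X \<Longrightarrow> m \<le> f z" and x: "x \<in> X"
  shows "(norm (dgrad f x))\<^sup>2 \<le> 2 * ell (2 * norm (dgrad f x)) * (f x - m)"
proof (cases "dgrad f x = 0")
  case True
  then show ?thesis using lower[OF x] ell_pos[of 0] by simp
next
  case False
  define G where "G = norm (dgrad f x)"
  define L where "L = ell (2 * G)"
  have G: "0 < G" using False by (simp add: G_def)
  have L: "0 < L" using ell_pos[of "2 * G"] G by (simp add: L_def)
  \<comment> \<open>\<theta> measures how nearly \<open>v\<close> attains the dual norm, and tends
    to 1 at the end. The condition \<open>1 / 2 < \<theta>\<close> lets the linear decrease dominate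
    the quadratic term on the whole segment.\<close>
  have bound: "(\<theta> - 1 / 2) * G\<^sup>2 / L \<le> f x - m" if \<theta>: "1 / 2 < \<theta>" "\<theta> < 1" for \<theta>
  proof -
    have "\<exists>v. norm v \<le> 1 \<and> \<theta> * G < dgrad f x v"
    proof (rule ccontr)
      assume no: "\<not> ?thesis"
      have "norm (dgrad f x) \<le> \<theta> * G"
        unfolding dual_norm_eq_Sup using no by (intro cSup_least) (auto intro: exI[of _ 0] simp: not_less)
      then show False using \<theta> G by (simp add: G_def)
    qed
    then obtain v where v: "norm v \<le> 1" "\<theta> * G < dgrad f x v" by blast
    define d where "d = - (G / L) *\<^sub>R v"
    have nd: "norm d \<le> G / L" using v G L mult_left_mono[of "norm v" 1 "G / L"] by (simp add: d_def)
    have dec: "f (x + s *\<^sub>R d) \<le> f x - s * \<theta> * G\<^sup>2 / L + s\<^sup>2 * G\<^sup>2 / (2 * L)"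
      if s: "s \<in> {0..1}" and sX: "x + s *\<^sub>R d \<in> X" for s
    proof -
      have nsd: "norm (s *\<^sub>R d) \<le> s * (G / L)" using mult_left_mono[OF nd, of s] s by simp
      also have "\<dots> \<le> 1 * (G / L)" using s G L by (intro mult_right_mono) auto
      finally have "L * norm (s *\<^sub>R d) \<le> G" using L by (simp add: field_simps)
      then have "f (x + s *\<^sub>R d) \<le> f x + dgrad f x (s *\<^sub>R d) + L / 2 * (norm (s *\<^sub>R d))\<^sup>2"
        unfolding L_def using x sX G by (intro descent_inequality) (auto simp: G_def)
      moreover have "dgrad f x (s *\<^sub>R d) \<le> - (s * \<theta> * G\<^sup>2 / L)"
      proof -
        have "s * (G / L) * (\<theta> * G) \<le> s * (G / L) * dgrad f x v"
          using s G L v(2) by (intro mult_left_mono) auto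
        then show ?thesis
          by (simp add: d_def blinfun.scaleR_right blinfun.minus_right power2_eq_square mult_ac)
      qed
      moreover have "L / 2 * (norm (s *\<^sub>R d))\<^sup>2 \<le> L / 2 * (s * (G / L))\<^sup>2"
        using nsd L by (intro mult_left_mono power_mono) auto
      moreover have "L / 2 * (s * (G / L))\<^sup>2 = s\<^sup>2 * G\<^sup>2 / (2 * L)"
        using L by (simp add: power2_eq_square field_simps)
      ultimately show ?thesis by linarith
    qed
    \<comment> \<open>The step stays in \<open>X\<close> by connectedness: \<open>U\<close> is open
      because \<open>X\<close> is, and closed because \<open>f\<close> does not exceed
      \<open>f x\<close> on it, which makes it the preimage of a closed sublevel set.\<close>
    define U where "U = {s \<in> {0..1}. x + s *\<^sub>R d \<in> X}"
    have U_eq: "U = {s \<in> {0..1}. x + s *\<^sub>R d \<in> {z \<in> X. f z \<le> f x}}"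
    proof -
      have "f (x + s *\<^sub>R d) \<le> f x" if "s \<in> U" for s
      proof -
        have s: "s \<in> {0..1}" "x + s *\<^sub>R d \<in> X" using that by (auto simp: U_def)
        have "s\<^sup>2 \<le> 2 * \<theta> * s" using s \<theta> mult_right_mono[of s "2 * \<theta>" s] by (simp add: power2_eq_square)
        then have "s\<^sup>2 * (G\<^sup>2 / (2 * L)) \<le> 2 * \<theta> * s * (G\<^sup>2 / (2 * L))"
          using L by (intro mult_right_mono) auto
        then show ?thesis using dec[OF s] by (simp add: mult_ac)
      qed
      then show ?thesis by (auto simp: U_def)
    qed
    have line: "continuous_on {0..1} (\<lambda>s. x + s *\<^sub>R d)" by (intro continuous_intros)
    have "openin (top_of_set {0..1}) U"
      using continuous_openin_preimage_gen[OF line X_open] by (simp add: U_def vimage_def Int_def)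
    moreover have "closedin (top_of_set {0..1}) U"
      using continuous_closedin_preimage[OF line closed[of "f x"]]
      unfolding U_eq by (simp add: vimage_def Int_def)
    moreover have "0 \<in> U" using x by (simp add: U_def)
    ultimately have "U = {0..1}"
      using connected_Icc[of "0::real" 1] unfolding connected_clopen by blast
    then have "1 \<in> U" by simp
    then have xd: "x + 1 *\<^sub>R d \<in> X" by (simp add: U_def)
    then have "m \<le> f x - 1 * \<theta> * G\<^sup>2 / L + 1\<^sup>2 * G\<^sup>2 / (2 * L)"
      using dec[of 1] lower[OF xd] by simp
    then show ?thesis using L by (simp add: field_simps)
  qed
  have "((\<lambda>\<theta>. (\<theta> - 1 / 2) * G\<^sup>2 / L) \<longlongrightarrow> (1 - 1 / 2) * G\<^sup>2 / L) (at_left 1)"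
    using L by (intro tendsto_intros) auto
  moreover have "\<forall>\<^sub>F \<theta> in at_left (1::real). (\<theta> - 1 / 2) * G\<^sup>2 / L \<le> f x - m"
    unfolding eventually_at_left_field using bound by (intro exI[of _ "1 / 2"]) auto
  ultimately have "(1 - 1 / 2) * G\<^sup>2 / L \<le> f x - m"
    by (rule tendsto_upperbound) simp
  then have "G\<^sup>2 \<le> 2 * L * (f x - m)" using L by (simp add: field_simps)
  then show ?thesis by (simp add: G_def L_def)
qed

end

section \<open>Mirror maps and Bregman functions\<close>

text \<open>Subtracting \<open>u\<close> from \<psi> leaves a function with a minimum over the open
  set \<open>X\<close> at \<open>x\<close>, so its derivative vanishes there.\<close>

lemma dgrad_eq_subgradient:
  fixes \<psi> :: "'a::real_normed_vector \<Rightarrow> real"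
  assumes "open X" "x \<in> X" "\<psi> differentiable (at x)" "u \<in> subdiff X \<psi> x"
  shows "dgrad \<psi> x = u"
proof -
  have "(\<lambda>h. dgrad \<psi> x h - u h) = (\<lambda>h. 0)"
  proof (rule differential_zero_maxmin[OF assms(2,1)])
    show "((\<lambda>z. \<psi> z - u z) has_derivative (\<lambda>h. dgrad \<psi> x h - u h)) (at x)"
      by (intro has_derivative_diff dgrad_has_derivative assms
          bounded_linear_imp_has_derivative blinfun.bounded_linear_right)
    show "(\<forall>y\<in>X. \<psi> y - u y \<le> \<psi> x - u x) \<or> (\<forall>y\<in>X. \<psi> x - u x \<le> \<psi> y - u y)"
      using assms(4) by (force simp: subdiff_def blinfun.diff_right)
  qed
  then show ?thesis by (intro blinfun_eqI) (metis eq_iff_diff_eq_0)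
qed

lemma bregman_three_point:
  "blinfun_apply (dgrad \<psi> y - dgrad \<psi> z) (z - w) = bregman \<psi> w y - bregman \<psi> w z - bregman \<psi> z y"
  by (simp add: bregman_def blinfun.diff_left blinfun.diff_right)

text \<open>The gradient at \<open>x\<close> is itself a subgradient. The point \<open>w\<close>
  ranges over all of \<open>X\<close> because the minimizer of \<open>f\<close> need not lie in
  \<open>subdiff_dom X \<psi>\<close>.\<close>

lemma mirror_map_bregman_nonneg:
  assumes "open X" "mirror_map X \<psi>" "x \<in> subdiff_dom X \<psi>" "w \<in> X"
  shows "0 \<le> bregman \<psi> w x"
proof -
  obtain u where u: "u \<in> subdiff X \<psi> x" "x \<in> X" using assms(3) by (auto simp: subdiff_dom_def)
  have "dgrad \<psi> x = u"
    using assms u by (intro dgrad_eq_subgradient) (auto simp: mirror_map_def)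
  then show ?thesis using u assms(4) by (force simp: bregman_def subdiff_def)
qed

text \<open>Strong monotonicity of the gradient is integrated along the segment, which stays in
  \<open>subdiff_dom X \<psi>\<close> by convexity of that set.\<close>

lemma mirror_map_bregman_ge:
  assumes \<psi>: "mirror_map X \<psi>" and y: "y \<in> subdiff_dom X \<psi>" and z: "z \<in> subdiff_dom X \<psi>"
  shows "(norm (z - y))\<^sup>2 / 2 \<le> bregman \<psi> z y"
proof -
  define d where "d = z - y"
  let ?\<theta> = "\<lambda>s. \<psi> (y + s *\<^sub>R d) - s * dgrad \<psi> y d - s\<^sup>2 / 2 * (norm d)\<^sup>2"
  have "?\<theta> 0 \<le> ?\<theta> 1"
  proof (rule DERIV_nonneg_imp_nondecreasing[where f = ?\<theta>])
    fix s :: real assume s: "0 \<le> s" "s \<le> 1"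
    define p where "p = y + s *\<^sub>R d"
    have p: "p \<in> subdiff_dom X \<psi>"
      unfolding p_def using \<psi> y z s
      by (intro segment_in_convex) (auto simp: mirror_map_def d_def)
    then have "(?\<theta> has_field_derivative (dgrad \<psi> p d - dgrad \<psi> y d - s * (norm d)\<^sup>2)) (at s)"
      using \<psi> unfolding p_def mirror_map_def
      by (auto intro!: derivative_eq_intros has_derivative_along_line)
    moreover have "s * (norm d)\<^sup>2 \<le> dgrad \<psi> p d - dgrad \<psi> y d"
    proof (cases "s = 0")
      case False
      have "(norm (p - y))\<^sup>2 \<le> blinfun_apply (dgrad \<psi> p - dgrad \<psi> y) (p - y)"
        using \<psi> p y by (simp add: mirror_map_def)
      then have "s * (s * (norm d)\<^sup>2) \<le> s * (dgrad \<psi> p d - dgrad \<psi> y d)"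
        by (simp add: p_def power_mult_distrib blinfun.scaleR_right blinfun.diff_left power2_eq_square mult_ac)
      then show ?thesis using False s by simp
    qed (simp add: p_def)
    ultimately show "\<exists>l. (?\<theta> has_field_derivative l) (at s) \<and> 0 \<le> l" by force
  qed simp
  then show ?thesis by (simp add: d_def bregman_def)
qed

text \<open>Minimality of \<open>z\<close>, rearranged, is the subgradient inequality at
  \<open>z\<close> for \<open>dgrad \<psi> y - g\<close>; differentiability then identifies this
  subgradient.\<close>

lemma prox_step:
  assumes X: "open X" and \<psi>: "mirror_map X \<psi>" and z: "z \<in> prox X \<psi> y g"
  shows "z \<in> subdiff_dom X \<psi>" "dgrad \<psi> z = dgrad \<psi> y - g"
proof -
  have zX: "z \<in> X"
    and min: "\<And>w. w \<in> X \<Longrightarrow> blinfun_apply g z + bregman \<psi> z y \<le> blinfun_apply g w + bregman \<psi> w y"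
    using z by (auto simp: prox_def is_arg_min_def not_less)
  have sub: "dgrad \<psi> y - g \<in> subdiff X \<psi> z"
    unfolding subdiff_def
    using min by (fastforce simp: bregman_def blinfun.diff_left blinfun.diff_right)
  show dom: "z \<in> subdiff_dom X \<psi>" using sub zX by (auto simp: subdiff_dom_def)
  show "dgrad \<psi> z = dgrad \<psi> y - g"
    using X zX dom \<psi> sub by (intro dgrad_eq_subgradient) (auto simp: mirror_map_def)
qed

section \<open>Gradient bound and convergence rate of mirror descent\<close>

lemma subquadratic_bdd_above:
  fixes ell :: "real \<Rightarrow> real"
  assumes pos: "\<And>\<alpha>. 0 \<le> \<alpha> \<Longrightarrow> 0 < ell \<alpha>"
    and sub: "filterlim (\<lambda>\<alpha>. \<alpha>\<^sup>2 / ell \<alpha>) at_top at_top"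
  shows "bdd_above {\<alpha>. 0 \<le> \<alpha> \<and> \<alpha>\<^sup>2 \<le> 2 * ell (2 * \<alpha>) * D}"
proof -
  \<comment> \<open>At the argument \<open>2 * \<alpha>\<close> the square contributes a factor 4,
    which reduces 8 to the 2 of the defining inequality.\<close>
  have "\<forall>\<^sub>F \<alpha> in at_top. 8 * D < \<alpha>\<^sup>2 / ell \<alpha>"
    using sub by (simp add: filterlim_at_top_dense)
  then obtain M where M: "\<And>\<alpha>. M \<le> \<alpha> \<Longrightarrow> 8 * D < \<alpha>\<^sup>2 / ell \<alpha>"
    by (auto simp: eventually_at_top_linorder)
  show ?thesis
  proof (rule bdd_aboveI[of _ "\<bar>M\<bar>"], rule ccontr)
    fix \<alpha> assume \<alpha>: "\<alpha> \<in> {\<alpha>. 0 \<le> \<alpha> \<and> \<alpha>\<^sup>2 \<le> 2 * ell (2 * \<alpha>) * D}" and "\<not> \<alpha> \<le> \<bar>M\<bar>"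
    then have "8 * D < (2 * \<alpha>)\<^sup>2 / ell (2 * \<alpha>)" by (intro M) auto
    then show False using \<alpha> pos[of "2 * \<alpha>"] by (simp add: field_simps power2_eq_square)
  qed
qed

theorem theorem3p5:
  fixes X :: "'a::banach set"
    and f \<psi> :: "'a \<Rightarrow> real"
    and ell :: "real \<Rightarrow> real"
    and x :: "nat \<Rightarrow> 'a"
    and xs :: 'a
    and G L \<eta> :: real
  assumes fin_dim: "\<exists>B :: 'a set. finite B \<and> span B = UNIV"
    and X_open: "open X"
    and X_convex: "convex X"
    and ell_pos: "\<forall>\<alpha>\<ge>0. ell \<alpha> > 0"
    and ell_mono: "mono_on {0..} ell"
    and ell_cont: "continuous_on {0..} ell"
    and ell_subquadratic: "filterlim (\<lambda>\<alpha>. \<alpha>\<^sup>2 / ell \<alpha>) at_top at_top"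
    and f_convex: "convex_on X f"
    and f_closed: "\<forall>a. closed {z \<in> X. f z \<le> a}"
    and f_smooth: "f \<in> ell_smooth_class ell X"
    and xs_min: "is_arg_min f (\<lambda>z. z \<in> X) xs"
    and mirror: "mirror_map X \<psi>"
    and x_init: "is_arg_min \<psi> (\<lambda>z. z \<in> X) (x 0)"
    and G_eq: "G = Sup {\<alpha>. 0 \<le> \<alpha> \<and> \<alpha>\<^sup>2 \<le> 2 * ell (2 * \<alpha>) * (f (x 0) - f xs)}"
    and L_eq: "L = ell (2 * G)"
    and eta: "0 < \<eta>" "\<eta> \<le> 1 / L"
    and x_step: "\<forall>t. x (Suc t) \<in> prox X \<psi> (x t) (\<eta> *\<^sub>R dgrad f (x t))"
  shows "(\<forall>t. norm (dgrad f (x t)) \<le> G) \<and>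
    (\<forall>T\<ge>1. max (f ((1 / real T) *\<^sub>R (\<Sum>t=1..T. x t)) - f xs) (f (x T) - f xs)
              \<le> bregman \<psi> xs (x 0) / (\<eta> * real T))"
proof -
  interpret ell_smooth X f ell
    using X_open X_convex ell_pos ell_mono f_smooth by unfold_locales auto
  have xsX: "xs \<in> X" and fmin: "\<And>z. z \<in> X \<Longrightarrow> f xs \<le> f z"
    using xs_min by (auto simp: is_arg_min_def not_less)
  have x0: "x 0 \<in> X" and \<psi>min: "\<And>z. z \<in> X \<Longrightarrow> \<psi> (x 0) \<le> \<psi> z"
    using x_init by (auto simp: is_arg_min_def not_less)
  have dom: "x t \<in> subdiff_dom X \<psi>" for t
  proof (cases t)
    case 0
    have "0 \<in> subdiff X \<psi> (x 0)" using \<psi>min by (simp add: subdiff_def)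
    then show ?thesis using 0 x0 by (auto simp: subdiff_dom_def)
  next
    case (Suc n)
    then show ?thesis using prox_step(1)[OF X_open mirror x_step[rule_format, of n]] by simp
  qed
  have xX: "x t \<in> X" for t using dom[of t] by (simp add: subdiff_dom_def)
  have step: "dgrad \<psi> (x (Suc t)) = dgrad \<psi> (x t) - \<eta> *\<^sub>R dgrad f (x t)" for t
    by (rule prox_step(2)[OF X_open mirror x_step[rule_format]])
  define \<A> where "\<A> = {\<alpha>. 0 \<le> \<alpha> \<and> \<alpha>\<^sup>2 \<le> 2 * ell (2 * \<alpha>) * (f (x 0) - f xs)}"
  have \<A>: "bdd_above \<A>"
    unfolding \<A>_def using ell_pos ell_subquadratic by (intro subquadratic_bdd_above) auto
  have G: "G = Sup \<A>" by (simp add: G_eq \<A>_def)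
  have "0 \<in> \<A>" using fmin[OF x0] ell_pos by (simp add: \<A>_def less_imp_le)
  then have G0: "0 \<le> G" unfolding G using \<A> by (rule cSup_upper)
  have L0: "0 < L" using ell_pos G0 by (simp add: L_eq)
  have \<eta>L: "\<eta> * L \<le> 1" "L \<le> 1 / \<eta>" using eta L0 by (auto simp: field_simps)
  \<comment> \<open>By \<open>dgrad_self_bound\<close> the gradient norm is itself a member of the
    set whose supremum is \<open>G\<close>.\<close>
  have grad_le: "norm (dgrad f z) \<le> G" if z: "z \<in> X" "f z \<le> f (x 0)" for z
  proof -
    let ?\<alpha> = "norm (dgrad f z)"
    have "?\<alpha>\<^sup>2 \<le> 2 * ell (2 * ?\<alpha>) * (f z - f xs)"
      using f_closed fmin z(1) by (intro dgrad_self_bound) auto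
    also have "\<dots> \<le> 2 * ell (2 * ?\<alpha>) * (f (x 0) - f xs)"
      using z(2) ell_pos by (intro mult_left_mono) (auto simp: less_imp_le)
    finally have "?\<alpha> \<in> \<A>" by (simp add: \<A>_def)
    then show ?thesis unfolding G using \<A> by (rule cSup_upper)
  qed
  \<comment> \<open>The condition on \<open>f (x t)\<close> supplies the gradient bound at
    \<open>x t\<close>; the second conclusion then carries it to the next iterate.\<close>
  have descent: "f (x (Suc t)) \<le> f (x t) + dgrad f (x t) (x (Suc t) - x t) + L / 2 * (norm (x (Suc t) - x t))\<^sup>2"
      "f (x (Suc t)) \<le> f (x t)"
    if "f (x t) \<le> f (x 0)" for t
  proof -
    define g where "g = dgrad f (x t)"
    define d where "d = x (Suc t) - x t"
    have xd: "x t + d = x (Suc t)" by (simp add: d_def)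
    have gG: "norm g \<le> G" unfolding g_def using grad_le xX that by blast
    have "(norm d)\<^sup>2 \<le> blinfun_apply (dgrad \<psi> (x (Suc t)) - dgrad \<psi> (x t)) d"
      unfolding d_def using mirror dom by (simp add: mirror_map_def)
    \<comment> \<open>This inequality serves twice: by Cauchy-Schwarz for the dual norm it bounds
      the step length, and it also makes the linear term negative enough for descent.\<close>
    then have sc: "(norm d)\<^sup>2 \<le> - (\<eta> * g d)"
      by (simp add: step g_def blinfun.minus_left blinfun.scaleR_left)
    have nd: "L * norm d \<le> G"
    proof -
      have "- (\<eta> * g d) \<le> \<eta> * (norm g * norm d)"
        using mult_left_mono[of "- g d" "norm g * norm d" \<eta>] norm_blinfun[of g d] eta(1) by simp
      then have "norm d * norm d \<le> (\<eta> * norm g) * norm d"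
        using sc by (simp add: power2_eq_square mult_ac)
      then have "norm d \<le> \<eta> * norm g" using eta(1) by (cases "d = 0") auto
      also have "\<eta> * norm g \<le> \<eta> * G" using gG eta(1) by simp
      finally have "L * norm d \<le> L * (\<eta> * G)" using L0 by simp
      also have "\<dots> \<le> G" using \<eta>L(1) G0 mult_right_mono[of "\<eta> * L" 1 G] by (simp add: mult_ac)
      finally show ?thesis .
    qed
    have desc: "f (x t + d) \<le> f (x t) + g d + L / 2 * (norm d)\<^sup>2"
    \<comment> \<open>\<open>descent_inequality\<close> needs \<open>0 < G\<close>; when
      \<open>G = 0\<close> the step itself is zero.\<close>
    proof (cases "G = 0")
      case True
      then have "d = 0" using nd L0 by (simp add: mult_le_0_iff)
      then show ?thesis by simp
    next
      case False
      then show ?thesis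
        unfolding L_eq g_def using nd xX gG G0
        by (intro descent_inequality) (auto simp: xd L_eq g_def)
    qed
    then show "f (x (Suc t)) \<le> f (x t) + dgrad f (x t) (x (Suc t) - x t) + L / 2 * (norm (x (Suc t) - x t))\<^sup>2"
      by (simp add: xd g_def d_def)
    have "g d \<le> - ((norm d)\<^sup>2 / \<eta>)" using sc eta(1) by (simp add: field_simps)
    moreover have "L / 2 * (norm d)\<^sup>2 \<le> (norm d)\<^sup>2 / \<eta>"
    proof -
      have "L / 2 * (norm d)\<^sup>2 \<le> 1 / \<eta> * (norm d)\<^sup>2"
        using \<eta>L(2) L0 by (intro mult_right_mono) auto
      then show ?thesis by simp
    qed
    ultimately show "f (x (Suc t)) \<le> f (x t)" using desc by (simp add: xd)
  qed
  have f_le: "f (x t) \<le> f (x 0)" for t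
  proof (induction t)
    case (Suc t)
    then show ?case using descent(2)[of t] by linarith
  qed simp
  have f_anti: "f (x T) \<le> f (x t)" if "t \<le> T" for t T
    using that
  proof (induction rule: dec_induct)
    case (step n)
    then show ?case using descent(2)[OF f_le, of n] by linarith
  qed simp
  \<comment> \<open>Convexity compares \<open>xs\<close> with the old iterate and descent compares
    the old iterate with the new one, so the left side involves the new iterate.\<close>
  have progress: "\<eta> * (f (x (Suc t)) - f xs) \<le> bregman \<psi> xs (x t) - bregman \<psi> xs (x (Suc t))" for t
  proof -
    let ?x = "x t" and ?y = "x (Suc t)"
    have 1: "f ?x + dgrad f ?x (xs - ?x) \<le> f xs"
      using f_convex xX xsX f_differentiable by (intro convex_on_dgrad_le) auto
    have "dgrad f ?x (?y - ?x) = dgrad f ?x (?y - xs) + dgrad f ?x (xs - ?x)"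
      by (simp add: blinfun.diff_right)
    then have "f ?y - f xs \<le> dgrad f ?x (?y - xs) + L / 2 * (norm (?y - ?x))\<^sup>2"
      using descent(1)[OF f_le, of t] 1 by linarith
    then have "\<eta> * (f ?y - f xs) \<le> \<eta> * (dgrad f ?x (?y - xs) + L / 2 * (norm (?y - ?x))\<^sup>2)"
      using eta(1) by (intro mult_left_mono) auto
    \<comment> \<open>The mirror step replaces the scaled gradient of \<open>f\<close> by a
      difference of gradients of \<psi>. Since \<open>\<eta> * L \<le> 1\<close>, the quadratic term
      is then absorbed by the Bregman term of the three-point identity.\<close>
    also have "\<dots> = blinfun_apply (dgrad \<psi> ?x - dgrad \<psi> ?y) (?y - xs) + (\<eta> * L) * ((norm (?y - ?x))\<^sup>2 / 2)"
      by (simp add: step blinfun.scaleR_left algebra_simps)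
    also have "\<dots> \<le> blinfun_apply (dgrad \<psi> ?x - dgrad \<psi> ?y) (?y - xs) + bregman \<psi> ?y ?x"
      using mult_right_mono[OF \<eta>L(1), of "(norm (?y - ?x))\<^sup>2 / 2"]
        mirror_map_bregman_ge[OF mirror dom[of t] dom[of "Suc t"]] by simp
    also have "\<dots> = bregman \<psi> xs ?x - bregman \<psi> xs ?y"
      by (simp add: bregman_three_point)
    finally show ?thesis .
  qed
  have sum_le: "\<eta> * (\<Sum>t=1..T. f (x t) - f xs) \<le> bregman \<psi> xs (x 0)" for T
  proof -
    have "\<eta> * (\<Sum>t=1..T. f (x t) - f xs) \<le> bregman \<psi> xs (x 0) - bregman \<psi> xs (x T)"
    proof (induction T)
      case (Suc T)
      then show ?case using progress[of T] by (simp add: distrib_left)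
    qed simp
    then show ?thesis using mirror_map_bregman_nonneg[OF X_open mirror dom[of T] xsX] by linarith
  qed
  have "max (f ((1 / real T) *\<^sub>R (\<Sum>t=1..T. x t)) - f xs) (f (x T) - f xs)
      \<le> bregman \<psi> xs (x 0) / (\<eta> * real T)" if T: "1 \<le> T" for T
  proof -
    \<comment> \<open>The mean gap dominates both quantities: the averaged iterate by Jensen's
      inequality, the last iterate because the values decrease.\<close>
    let ?S = "\<Sum>t=1..T. f (x t) - f xs"
    have S: "?S / real T \<le> bregman \<psi> xs (x 0) / (\<eta> * real T)"
      using sum_le[of T] eta(1) T by (simp add: field_simps)
    have "f (\<Sum>t=1..T. (1 / real T) *\<^sub>R x t) \<le> (\<Sum>t=1..T. (1 / real T) * f (x t))"
      using T f_convex xX by (intro convex_on_sum) auto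
    moreover have "?S / real T = (\<Sum>t=1..T. (1 / real T) * f (x t)) - f xs"
      using T by (simp add: sum_subtractf diff_divide_distrib flip: sum_divide_distrib)
    ultimately have avg: "f ((1 / real T) *\<^sub>R (\<Sum>t=1..T. x t)) - f xs \<le> ?S / real T"
      by (simp add: scaleR_sum_right)
    have "(\<Sum>t=1..T. f (x T) - f xs) \<le> ?S"
      by (intro sum_mono) (simp add: f_anti)
    then have "f (x T) - f xs \<le> ?S / real T" using T by (simp add: field_simps)
    with avg S show ?thesis by simp
  qed
  then show ?thesis using grad_le xX f_le by blast
qed

end
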